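(* The uniform one-dimensional fragment $\mathrm{UF}_1$ is incomparable in expressivity with two-variable logic with counting $\mathrm{FOC}^2$ and also with the guarded negation fragment $\mathrm{GNFO}$. That is, for each $\mathcal{L}\in\{\mathrm{FOC}^2,\mathrm{GNFO}\}$, there is a sentence of $\mathrm{UF}_1$ that is not equivalent to any sentence of $\mathcal{L}$, and there is a sentence of $\mathcal{L}$ that is not equivalent to any sentence of $\mathrm{UF}_1$.
   Context: Let $\mathcal{T}=\bigcup_{k\ge 1}\tau_k$ be the complete relational vocabulary, where $\tau_k$ is a countably infinite set of $k$-ary relation symbols; every vocabulary is a subset of $\mathcal{T}$ (no constants, no function symbols). Symbols $x,y,z,y_i,z_i$ are meta-variables ranging over a countably infinite set of variable symbols; different meta-variables may denote the same variable. Two sentences are equivalent if they are true in exactly the same models (over every vocabulary containing the relation symbols of both). Definition of $\mathrm{UF}_1$. An atomic formula is unary if exactly one distinct variable occurs in it. For a finite set $Y$ of variables, a $Y$-uniform set is a finite set of atomic formulae $R(z_1,\dots,z_k)$ with $\{z_1,\dots,z_k\}=Y$ (the empty set is $\emptyset$-uniform). For $\tau\subseteq\mathcal{T}$, $\mathrm{UF}_1(\tau)$ is the smallest set $\mathcal{F}$ such that: (i) every unary $\tau$-atom is in $\mathcal{F}$, and $\bot,\top\in\mathcal{F}$; (ii) $\mathcal{F}$ is closed under $\neg$ and $\wedge$; (iii) if $Y=\{y_1,\dots,y_k\}$ is a set of variable symbols, $U$ is a finite set of formulae in $\mathcal{F}$ whose free variables are in $Y$, $V\subseteq Y$, $F$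 is a $V$-uniform set of $\tau$-atoms, and $\varphi$ is any Boolean combination of formulae in $U\cup F$, then $\exists y_2\dots\exists y_k\,\varphi\in\mathcal{F}$; (iv) if $\varphi\in\mathcal{F}$ then $\exists y\,\varphi\in\mathcal{F}$. There is no equality symbol in $\mathrm{UF}_1$. $\mathrm{UF}_1:=\mathrm{UF}_1(\mathcal{T})$. $\mathrm{FOC}^2$ is the extension of two-variable first-order logic (formulae with equality over $\mathcal{T}$ using only two variable symbols) by counting quantifiers $\exists^{\ge n}$, $n\ge 1$. $\mathrm{GNFO}$ is the set of formulae over $\mathcal{T}$ generated by $\varphi ::= R(z_1,\dots,z_k)\mid x=y\mid \varphi\wedge\varphi\mid\varphi\vee\varphi\mid\exists x\,\varphi\mid \alpha\wedge\neg\varphi$, where in $\alpha\wedge\neg\varphi$ the formula $\alpha$ is atomic (possibly an equality) and every free variable of $\varphi$ occurs in $\alpha$. *)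

theory Defs
  imports Main
begin

text \<open>
  \<open>RelSym k i\<close> is the \<open>i\<close>-th symbol of arity \<open>k + 1\<close>: there are countably infinitely
  many symbols of every arity \<open>\<ge> 1\<close> and none of arity 0. The complete vocabulary is
  \<open>UNIV\<close>, a vocabulary is any \<open>relsym set\<close>.
\<close>

datatype relsym = RelSym nat nat

primrec arity :: "relsym \<Rightarrow> nat" where
  "arity (RelSym k i) = Suc k"

type_synonym var = nat

text \<open>
  One syntax in which all fragments are carved out as sets of formulae.
  \<open>ExGe n x \<phi>\<close> is the counting quantifier ``there are at least \<open>n\<close> elements \<open>x\<close>''.
  The type does not enforce arities; membership in the fragments does.
\<close>

datatype fm =
    Bot
  | Top
  | Atom relsym "var list"
  | Eq var var
  | Neg fm
  | And fm fm
  | Or fm fm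
  | Ex var fm
  | ExGe nat var fm

primrec vars :: "fm \<Rightarrow> var set" where
  "vars Bot = {}"
| "vars Top = {}"
| "vars (Atom R zs) = set zs"
| "vars (Eq x y) = {x, y}"
| "vars (Neg \<phi>) = vars \<phi>"
| "vars (And \<phi> \<psi>) = vars \<phi> \<union> vars \<psi>"
| "vars (Or \<phi> \<psi>) = vars \<phi> \<union> vars \<psi>"
| "vars (Ex x \<phi>) = insert x (vars \<phi>)"
| "vars (ExGe n x \<phi>) = insert x (vars \<phi>)"

primrec fv :: "fm \<Rightarrow> var set" where
  "fv Bot = {}"
| "fv Top = {}"
| "fv (Atom R zs) = set zs"
| "fv (Eq x y) = {x, y}"
| "fv (Neg \<phi>) = fv \<phi>"
| "fv (And \<phi> \<psi>) = fv \<phi> \<union> fv \<psi>"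
| "fv (Or \<phi> \<psi>) = fv \<phi> \<union> fv \<psi>"
| "fv (Ex x \<phi>) = fv \<phi> - {x}"
| "fv (ExGe n x \<phi>) = fv \<phi> - {x}"

primrec rels :: "fm \<Rightarrow> relsym set" where
  "rels Bot = {}"
| "rels Top = {}"
| "rels (Atom R zs) = {R}"
| "rels (Eq x y) = {}"
| "rels (Neg \<phi>) = rels \<phi>"
| "rels (And \<phi> \<psi>) = rels \<phi> \<union> rels \<psi>"
| "rels (Or \<phi> \<psi>) = rels \<phi> \<union> rels \<psi>"
| "rels (Ex x \<phi>) = rels \<phi>"
| "rels (ExGe n x \<phi>) = rels \<phi>"

definition sentences :: "fm set \<Rightarrow> fm set" where
  "sentences L = {\<phi> \<in> L. fv \<phi> = {}}"

record 'u model =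
  vocab :: "relsym set"
  universe :: "'u set"
  interp :: "relsym \<Rightarrow> 'u list set"

text \<open>Values of \<^const>\<open>interp\<close> outside the vocabulary are junk and are never consulted.\<close>

definition is_model :: "'u model \<Rightarrow> bool" where
  "is_model M \<longleftrightarrow> universe M \<noteq> {} \<and>
     (\<forall>R \<in> vocab M. interp M R \<subseteq> {as. length as = arity R \<and> set as \<subseteq> universe M})"

primrec sat :: "'u model \<Rightarrow> (var \<Rightarrow> 'u) \<Rightarrow> fm \<Rightarrow> bool" where
  "sat M s Bot \<longleftrightarrow> False"
| "sat M s Top \<longleftrightarrow> True"
| "sat M s (Atom R zs) \<longleftrightarrow> map s zs \<in> interp M R"
| "sat M s (Eq x y) \<longleftrightarrow> s x = s y"
| "sat M s (Neg \<phi>) \<longleftrightarrow> \<not> sat M s \<phi>"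
| "sat M s (And \<phi> \<psi>) \<longleftrightarrow> sat M s \<phi> \<and> sat M s \<psi>"
| "sat M s (Or \<phi> \<psi>) \<longleftrightarrow> sat M s \<phi> \<or> sat M s \<psi>"
| "sat M s (Ex x \<phi>) \<longleftrightarrow> (\<exists>a \<in> universe M. sat M (s(x := a)) \<phi>)"
| "sat M s (ExGe n x \<phi>) \<longleftrightarrow>
     (\<exists>S \<subseteq> universe M. finite S \<and> card S = n \<and> (\<forall>a \<in> S. sat M (s(x := a)) \<phi>))"

text \<open>
  For a sentence the quantifier over assignments is vacuous, since the truth value depends
  on free variables only and the universe of a model is nonempty.
\<close>

definition true_in :: "'u model \<Rightarrow> fm \<Rightarrow> bool" where
  "true_in M \<phi> \<longleftrightarrow> (\<forall>s. range s \<subseteq> universe M \<longrightarrow> sat M s \<phi>)"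

text \<open>
  HOL cannot quantify over all sets, so the models range over those whose universe is a
  nonempty set of elements of the type \<open>'u\<close>. Inequivalence in this sense implies
  inequivalence over all models; for infinite \<open>'u\<close> the two notions agree, by the downward
  Loewenheim-Skolem theorem.
\<close>

definition equivalent :: "'u itself \<Rightarrow> fm \<Rightarrow> fm \<Rightarrow> bool" where
  "equivalent (_ :: 'u itself) \<phi> \<psi> \<longleftrightarrow>
     (\<forall>M :: 'u model. is_model M \<and> rels \<phi> \<union> rels \<psi> \<subseteq> vocab M
        \<longrightarrow> (true_in M \<phi> \<longleftrightarrow> true_in M \<psi>))"

definition atoms :: "relsym set \<Rightarrow> fm set" where
  "atoms \<tau> = {Atom R zs | R zs. R \<in> \<tau> \<and> length zs = arity R}"

definition uniform_set :: "relsym set \<Rightarrow> var set \<Rightarrow> fm set \<Rightarrow> bool" where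
  "uniform_set \<tau> Y F \<longleftrightarrow> finite F \<and> F \<subseteq> {\<alpha> \<in> atoms \<tau>. fv \<alpha> = Y}"

inductive_set bool_comb :: "fm set \<Rightarrow> fm set" for S where
  base: "\<phi> \<in> S \<Longrightarrow> \<phi> \<in> bool_comb S"
| neg: "\<phi> \<in> bool_comb S \<Longrightarrow> Neg \<phi> \<in> bool_comb S"
| conj: "\<lbrakk>\<phi> \<in> bool_comb S; \<psi> \<in> bool_comb S\<rbrakk> \<Longrightarrow> And \<phi> \<psi> \<in> bool_comb S"
| disj: "\<lbrakk>\<phi> \<in> bool_comb S; \<psi> \<in> bool_comb S\<rbrakk> \<Longrightarrow> Or \<phi> \<psi> \<in> bool_comb S"

text \<open>
  In rule \<open>block\<close>, \<open>y # ys\<close> lists \<open>y\<^sub>1, \<dots>, y\<^sub>k\<close>, possibly with repetitions (distinct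
  metavariables may denote the same variable), and \<open>foldr Ex ys \<phi>\<close> is
  \<open>\<exists>y\<^sub>2 \<dots> \<exists>y\<^sub>k. \<phi>\<close>.
\<close>

inductive_set uf1_over :: "relsym set \<Rightarrow> fm set" for \<tau> where
  unary: "\<lbrakk>\<alpha> \<in> atoms \<tau>; card (fv \<alpha>) = 1\<rbrakk> \<Longrightarrow> \<alpha> \<in> uf1_over \<tau>"
| bot: "Bot \<in> uf1_over \<tau>"
| top: "Top \<in> uf1_over \<tau>"
| neg: "\<phi> \<in> uf1_over \<tau> \<Longrightarrow> Neg \<phi> \<in> uf1_over \<tau>"
| conj: "\<lbrakk>\<phi> \<in> uf1_over \<tau>; \<psi> \<in> uf1_over \<tau>\<rbrakk> \<Longrightarrow> And \<phi> \<psi> \<in> uf1_over \<tau>"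
| block: "\<lbrakk>finite U; \<forall>\<psi> \<in> U. \<psi> \<in> uf1_over \<tau> \<and> fv \<psi> \<subseteq> set (y # ys);
           V \<subseteq> set (y # ys); uniform_set \<tau> V F; \<phi> \<in> bool_comb (U \<union> F)\<rbrakk>
          \<Longrightarrow> foldr Ex ys \<phi> \<in> uf1_over \<tau>"
| ex: "\<phi> \<in> uf1_over \<tau> \<Longrightarrow> Ex y \<phi> \<in> uf1_over \<tau>"

definition UF1 :: "fm set" where
  "UF1 = uf1_over UNIV"

text \<open>First-order logic with equality and counting quantifiers \<open>\<exists>\<^sup>\<ge>\<^sup>n\<close>, \<open>n \<ge> 1\<close>.\<close>

inductive_set FOC :: "fm set" where
  bot: "Bot \<in> FOC"
| top: "Top \<in> FOC"
| atom: "\<alpha> \<in> atoms UNIV \<Longrightarrow> \<alpha> \<in> FOC"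
| eq: "Eq x y \<in> FOC"
| neg: "\<phi> \<in> FOC \<Longrightarrow> Neg \<phi> \<in> FOC"
| conj: "\<lbrakk>\<phi> \<in> FOC; \<psi> \<in> FOC\<rbrakk> \<Longrightarrow> And \<phi> \<psi> \<in> FOC"
| disj: "\<lbrakk>\<phi> \<in> FOC; \<psi> \<in> FOC\<rbrakk> \<Longrightarrow> Or \<phi> \<psi> \<in> FOC"
| ex: "\<phi> \<in> FOC \<Longrightarrow> Ex x \<phi> \<in> FOC"
| exge: "\<lbrakk>\<phi> \<in> FOC; n \<ge> 1\<rbrakk> \<Longrightarrow> ExGe n x \<phi> \<in> FOC"

text \<open>
  At most two variable symbols may occur, free or bound; which two is left open and may
  depend on the formula.
\<close>

definition FOC2 :: "fm set" where
  "FOC2 = {\<phi> \<in> FOC. card (vars \<phi>) \<le> 2}"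

inductive_set GNFO :: "fm set" where
  atom: "\<alpha> \<in> atoms UNIV \<Longrightarrow> \<alpha> \<in> GNFO"
| eq: "Eq x y \<in> GNFO"
| conj: "\<lbrakk>\<phi> \<in> GNFO; \<psi> \<in> GNFO\<rbrakk> \<Longrightarrow> And \<phi> \<psi> \<in> GNFO"
| disj: "\<lbrakk>\<phi> \<in> GNFO; \<psi> \<in> GNFO\<rbrakk> \<Longrightarrow> Or \<phi> \<psi> \<in> GNFO"
| ex: "\<phi> \<in> GNFO \<Longrightarrow> Ex x \<phi> \<in> GNFO"
| guarded_neg: "\<lbrakk>\<alpha> \<in> atoms UNIV \<union> range (\<lambda>(x, y). Eq x y); \<phi> \<in> GNFO; fv \<phi> \<subseteq> fv \<alpha>\<rbrakk>
                \<Longrightarrow> And \<alpha> (Neg \<phi>) \<in> GNFO"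

end

theory Submission
  imports Defs
begin

text \<open>
  Each of the four inexpressibility claims is witnessed by one pair of structures that every
  sentence of the weaker logic fails to tell apart.

  Two-variable logic: evaluating a formula with \<open>k\<close> variable symbols only ever consults tuples
  with at most \<open>k\<close> distinct entries, and counting quantifiers do not change this
  (\<open>sat_cong_few_vars\<close>). So the presence of one ternary fact with three distinct entries, which
  the sentence \<open>\<exists>x y z. R(x,y,z)\<close> detects, is invisible.

  Guarded negation: in a structure whose facts are exactly the constant tuples, each guard that
  holds pins all its variables to a single element. A negated formula is therefore evaluated only at
  constant assignments, and all such structures satisfy the same \<open>GNFO\<close> sentences, whatever their size
  (\<open>GNFO_diagonal\<close>). The sentence \<open>\<exists>x y. \<not> R(x,y)\<close> separates size one from size two.

  Conversely, formulae of \<open>UF\<^sub>1\<close> do not contain equality, so they do not change their truth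
  value when an element is blown up to several indistinguishable copies
  (\<open>sat_strong_surjection\<close>). The sentence \<open>\<exists>x y. R(x,y) \<and> x \<noteq> y\<close> does notice this, and it lies
  both in \<open>FOC\<^sup>2\<close> and in \<open>GNFO\<close>, its negation being guarded by \<open>R(x,y)\<close>.
\<close>

section \<open>Sentences and separating pairs of models\<close>

lemma sat_cong_fv:
  "(\<And>x. x \<in> fv \<phi> \<Longrightarrow> s x = t x) \<Longrightarrow> sat M s \<phi> \<longleftrightarrow> sat M t \<phi>"
proof (induction \<phi> arbitrary: s t)
  case (Atom R zs)
  then have "map s zs = map t zs" by simp
  then show ?case by (simp only: sat.simps)
next
  case (Neg \<phi>)
  from Neg.IH[of s t] Neg.prems show ?case by simp
next
  case (And \<phi> \<psi>)
  from And.IH[of s t] And.prems show ?case by simp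
next
  case (Or \<phi> \<psi>)
  from Or.IH[of s t] Or.prems show ?case by simp
next
  case (Ex x \<phi>)
  have "sat M (s(x := a)) \<phi> \<longleftrightarrow> sat M (t(x := a)) \<phi>" for a
    by (rule Ex.IH) (use Ex.prems in auto)
  then show ?case by simp
next
  case (ExGe n x \<phi>)
  have "sat M (s(x := a)) \<phi> \<longleftrightarrow> sat M (t(x := a)) \<phi>" for a
    by (rule ExGe.IH) (use ExGe.prems in auto)
  then show ?case by simp
qed simp_all

lemma true_in_sentence:
  assumes "fv \<phi> = {}" and "range s \<subseteq> universe M"
  shows "true_in M \<phi> \<longleftrightarrow> sat M s \<phi>"
  unfolding true_in_def using assms sat_cong_fv[of \<phi>] by (metis empty_iff)

lemma not_equivalentI:
  fixes M N :: "'u model"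
  assumes "is_model M" "vocab M = UNIV" and "is_model N" "vocab N = UNIV"
    and "true_in M \<phi> \<noteq> true_in N \<phi>" and "true_in M \<psi> \<longleftrightarrow> true_in N \<psi>"
  shows "\<not> equivalent TYPE('u) \<phi> \<psi>"
  using assms unfolding equivalent_def by (metis subset_UNIV)

section \<open>Formulae with few variables\<close>

text \<open>
  Under an assignment, an atom over \<open>k\<close> variables denotes a tuple with at most \<open>k\<close> distinct
  entries. The bound is on all variables, bound ones included, since it has to survive the
  passage to a subformula.
\<close>

lemma sat_cong_few_vars:
  assumes univ: "universe M = universe N"
    and agree: "\<And>R as. card (set as) \<le> k \<Longrightarrow> as \<in> interp M R \<longleftrightarrow> as \<in> interp N R"
    and X: "finite X" "card X \<le> k"
  shows "vars \<phi> \<subseteq> X \<Longrightarrow> sat M s \<phi> \<longleftrightarrow> sat N s \<phi>"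
proof (induction \<phi> arbitrary: s)
  case (Atom R zs)
  then have "card (s ` set zs) \<le> k"
    using X by (metis card_image_le card_mono finite_subset order_trans vars.simps(3))
  then show ?case using agree by simp
qed (simp_all add: univ)

lemma finite_vars: "finite (vars \<phi>)"
  by (induction \<phi>) simp_all

section \<open>Guarded negation on diagonal structures\<close>

definition diagonal :: "'u set \<Rightarrow> 'u model" where
  "diagonal A = \<lparr>vocab = UNIV, universe = A, interp = (\<lambda>R. (\<lambda>c. replicate (arity R) c) ` A)\<rparr>"

lemma is_model_diagonal: "A \<noteq> {} \<Longrightarrow> is_model (diagonal A)"
  by (auto simp: is_model_def diagonal_def)

lemma fv_nonempty_guard:
  assumes "\<alpha> \<in> atoms UNIV \<union> range (\<lambda>(x, y). Eq x y)"
  shows "fv \<alpha> \<noteq> {}"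
proof -
  have "arity R \<noteq> 0" for R by (cases R) simp
  then have "zs \<noteq> []" if "length zs = arity R" for zs :: "var list" and R
    using that by (metis list.size(3))
  then show ?thesis using assms by (auto simp: atoms_def)
qed

text \<open>
  The structure carrying the assignment \<open>s\<close> and the one carrying the constant assignment are both
  arbitrary, because the negation step uses the induction hypothesis in the opposite
  direction: there the guard makes \<open>s\<close> constant on the variables that matter.
\<close>

lemma GNFO_diagonal:
  fixes A B :: "'u set"
  assumes "\<phi> \<in> GNFO"
  shows "range s \<subseteq> A \<Longrightarrow> b \<in> B \<Longrightarrow> sat (diagonal A) s \<phi> \<Longrightarrow> sat (diagonal B) (\<lambda>_. b) \<phi>"
  using assms
proof (induction \<phi> arbitrary: A B s b rule: GNFO.induct)
  case (atom \<alpha>)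
  then show ?case by (auto simp: atoms_def diagonal_def map_replicate_const)
next
  case (ex \<phi> x)
  then obtain a where a: "a \<in> A" "sat (diagonal A) (s(x := a)) \<phi>"
    by (auto simp: diagonal_def)
  moreover have "range (s(x := a)) \<subseteq> A" using ex.prems(1) a(1) by auto
  ultimately have "sat (diagonal B) (\<lambda>_. b) \<phi>" using ex.IH ex.prems(2) by blast
  then have "sat (diagonal B) ((\<lambda>_. b)(x := b)) \<phi>" by (simp add: fun_upd_idem)
  then show ?case using ex.prems(2) by (auto simp: diagonal_def)
next
  case (guarded_neg \<alpha> \<phi>)
  have s\<alpha>: "sat (diagonal A) s \<alpha>" and s\<phi>: "\<not> sat (diagonal A) s \<phi>"
    using guarded_neg.prems by simp_all
  have "x \<in> set zs \<Longrightarrow> s x = c" if "map s zs = replicate n c" for zs n c x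
    using that by (metis imageI in_set_replicate list.set_map)
  then have "\<exists>c. \<forall>x \<in> fv \<alpha>. s x = c"
    using guarded_neg.hyps(1) s\<alpha> by (fastforce simp: atoms_def diagonal_def)
  then obtain c where c: "\<And>x. x \<in> fv \<alpha> \<Longrightarrow> s x = c" by blast
  \<comment> \<open>There is no symbol of arity 0, so the common value is attained on some variable.\<close>
  have cA: "c \<in> A"
    using fv_nonempty_guard[OF guarded_neg.hyps(1)] c guarded_neg.prems(1) by blast
  have "sat (diagonal B) (\<lambda>_. b) \<alpha>"
    using guarded_neg.hyps(1) s\<alpha> guarded_neg.prems(2)
    by (auto simp: atoms_def diagonal_def map_replicate_const)
  moreover have "\<not> sat (diagonal B) (\<lambda>_. b) \<phi>"
  proof
    assume "sat (diagonal B) (\<lambda>_. b) \<phi>"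
    then have "sat (diagonal A) (\<lambda>_. c) \<phi>"
      using guarded_neg.IH[of "\<lambda>_. b" B c A] guarded_neg.prems(2) cA by auto
    moreover have "sat (diagonal A) s \<phi> \<longleftrightarrow> sat (diagonal A) (\<lambda>_. c) \<phi>"
      by (rule sat_cong_fv) (use c guarded_neg.hyps in auto)
    ultimately show False using s\<phi> by simp
  qed
  ultimately show ?case by simp
qed auto

section \<open>Equality-free formulae and copies of elements\<close>

text \<open>
  Counting quantifiers are excluded together with equality: already \<open>\<exists>\<^sup>\<ge>\<^sup>2 x. \<top>\<close> distinguishes
  an element from two copies of it.
\<close>

primrec eq_free :: "fm \<Rightarrow> bool" where
  "eq_free Bot \<longleftrightarrow> True"
| "eq_free Top \<longleftrightarrow> True"
| "eq_free (Atom R zs) \<longleftrightarrow> True"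
| "eq_free (Eq x y) \<longleftrightarrow> False"
| "eq_free (Neg \<phi>) \<longleftrightarrow> eq_free \<phi>"
| "eq_free (And \<phi> \<psi>) \<longleftrightarrow> eq_free \<phi> \<and> eq_free \<psi>"
| "eq_free (Or \<phi> \<psi>) \<longleftrightarrow> eq_free \<phi> \<and> eq_free \<psi>"
| "eq_free (Ex x \<phi>) \<longleftrightarrow> eq_free \<phi>"
| "eq_free (ExGe n x \<phi>) \<longleftrightarrow> False"

lemma eq_free_foldr_Ex: "eq_free (foldr Ex ys \<phi>) \<longleftrightarrow> eq_free \<phi>"
  by (induction ys) simp_all

lemma eq_free_bool_comb:
  "\<phi> \<in> bool_comb S \<Longrightarrow> \<forall>\<psi> \<in> S. eq_free \<psi> \<Longrightarrow> eq_free \<phi>"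
  by (induction rule: bool_comb.induct) simp_all

lemma eq_free_uf1_over: "\<phi> \<in> uf1_over \<tau> \<Longrightarrow> eq_free \<phi>"
proof (induction rule: uf1_over.induct)
  case (block U y ys V F \<phi>)
  have "\<forall>\<psi> \<in> U \<union> F. eq_free \<psi>"
    using block by (auto simp: uniform_set_def atoms_def)
  then show ?case
    using eq_free_bool_comb block.hyps(4) block by (auto simp: eq_free_foldr_Ex)
qed (auto simp: atoms_def)

text \<open>
  A surjection that preserves and reflects all relations need not be injective, and only
  equality, explicit or hidden in a counting quantifier, could observe that.
\<close>

lemma sat_strong_surjection:
  assumes surj: "h ` universe M = universe N"
    and strong: "\<And>R as. set as \<subseteq> universe M \<Longrightarrow> as \<in> interp M R \<longleftrightarrow> map h as \<in> interp N R"
  shows "eq_free \<phi> \<Longrightarrow> range s \<subseteq> universe M \<Longrightarrow> sat M s \<phi> \<longleftrightarrow> sat N (h \<circ> s) \<phi>"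
proof (induction \<phi> arbitrary: s)
  case (Atom R zs)
  then have "set (map s zs) \<subseteq> universe M" by auto
  then show ?case using strong[of "map s zs" R] by (simp add: comp_def)
next
  case (Ex x \<phi>)
  have "sat M (s(x := a)) \<phi> \<longleftrightarrow> sat N ((h \<circ> s)(x := h a)) \<phi>" if "a \<in> universe M" for a
  proof -
    have "range (s(x := a)) \<subseteq> universe M" using Ex.prems(2) that by auto
    then have "sat M (s(x := a)) \<phi> \<longleftrightarrow> sat N (h \<circ> s(x := a)) \<phi>"
      using Ex.IH Ex.prems(1) by (metis eq_free.simps(8))
    then show ?thesis by (simp only: fun_upd_comp)
  qed
  then show ?case by (auto simp: comp_def simp flip: surj)
qed simp_all

definition complete :: "'u set \<Rightarrow> 'u model" where
  "complete A = \<lparr>vocab = UNIV, universe = A,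
     interp = (\<lambda>R. {as. length as = arity R \<and> set as \<subseteq> A})\<rparr>"

lemma is_model_complete: "A \<noteq> {} \<Longrightarrow> is_model (complete A)"
  by (auto simp: is_model_def complete_def)

lemma true_in_complete_UF1:
  assumes "\<phi> \<in> sentences UF1" and "a \<in> A"
  shows "true_in (complete A) \<phi> \<longleftrightarrow> true_in (complete {a}) \<phi>"
proof -
  have fv: "fv \<phi> = {}" and free: "eq_free \<phi>"
    using assms(1) eq_free_uf1_over by (auto simp: sentences_def UF1_def)
  have "sat (complete A) (\<lambda>_. a) \<phi> \<longleftrightarrow> sat (complete {a}) ((\<lambda>_. a) \<circ> (\<lambda>_. a)) \<phi>"
    by (rule sat_strong_surjection) (use assms(2) free in \<open>auto simp: complete_def\<close>)
  then have "sat (complete A) (\<lambda>_. a) \<phi> \<longleftrightarrow> sat (complete {a}) (\<lambda>_. a) \<phi>"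
    by (simp add: comp_def)
  moreover have "true_in (complete A) \<phi> \<longleftrightarrow> sat (complete A) (\<lambda>_. a) \<phi>"
    by (rule true_in_sentence[OF fv]) (use assms(2) in \<open>auto simp: complete_def\<close>)
  moreover have "true_in (complete {a}) \<phi> \<longleftrightarrow> sat (complete {a}) (\<lambda>_. a) \<phi>"
    by (rule true_in_sentence[OF fv]) (auto simp: complete_def)
  ultimately show ?thesis by simp
qed

section \<open>The separating sentences\<close>

definition some_triple :: fm where
  "some_triple = Ex 0 (Ex 1 (Ex 2 (Atom (RelSym 2 0) [0, 1, 2])))"

definition some_non_edge :: fm where
  "some_non_edge = Ex 0 (Ex 1 (Neg (Atom (RelSym 1 0) [0, 1])))"

definition some_proper_edge :: fm where
  "some_proper_edge = Ex 0 (Ex 1 (And (Atom (RelSym 1 0) [0, 1]) (Neg (Eq 0 1))))"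

lemma some_triple_UF1: "some_triple \<in> sentences UF1"
proof -
  let ?\<alpha> = "Atom (RelSym 2 0) [0, 1, 2]"
  have "foldr Ex [1, 2] ?\<alpha> \<in> uf1_over UNIV"
    by (rule uf1_over.block[where U = "{}" and F = "{?\<alpha>}" and y = 0 and V = "{0, 1, 2}"])
      (auto simp: uniform_set_def atoms_def intro: bool_comb.base)
  then show ?thesis
    by (auto simp: some_triple_def sentences_def UF1_def intro: uf1_over.ex)
qed

lemma some_non_edge_UF1: "some_non_edge \<in> sentences UF1"
proof -
  let ?\<alpha> = "Atom (RelSym 1 0) [0, 1]"
  have "foldr Ex [1] (Neg ?\<alpha>) \<in> uf1_over UNIV"
    by (rule uf1_over.block[where U = "{}" and F = "{?\<alpha>}" and y = 0 and V = "{0, 1}"])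
      (auto simp: uniform_set_def atoms_def intro: bool_comb.intros)
  then show ?thesis
    by (auto simp: some_non_edge_def sentences_def UF1_def intro: uf1_over.ex)
qed

lemma some_proper_edge_FOC2: "some_proper_edge \<in> sentences FOC2"
proof -
  have "Atom (RelSym 1 0) [0, 1] \<in> FOC" by (rule FOC.atom) (simp add: atoms_def)
  then have "some_proper_edge \<in> FOC"
    unfolding some_proper_edge_def by (intro FOC.ex FOC.conj FOC.neg FOC.eq)
  then show ?thesis
    by (auto simp: some_proper_edge_def sentences_def FOC2_def insert_commute)
qed

lemma some_proper_edge_GNFO: "some_proper_edge \<in> sentences GNFO"
proof -
  have "And (Atom (RelSym 1 0) [0, 1]) (Neg (Eq 0 1)) \<in> GNFO"
    by (rule GNFO.guarded_neg) (auto simp: atoms_def intro: GNFO.eq)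
  then show ?thesis
    by (auto simp: some_proper_edge_def sentences_def intro!: GNFO.ex)
qed

lemma some_triple_not_FOC2:
  assumes inf: "infinite (UNIV :: 'u set)" and \<psi>: "\<psi> \<in> sentences FOC2"
  shows "\<not> equivalent TYPE('u) some_triple \<psi>"
proof -
  obtain T :: "'u set" where "card T = 3"
    using infinite_arbitrarily_large[OF inf] by blast
  then obtain a b c :: 'u where abc: "a \<noteq> b" "a \<noteq> c" "b \<noteq> c"
    by (metis card_3_iff)
  define M :: "'u model" where
    "M = \<lparr>vocab = UNIV, universe = UNIV, interp = (\<lambda>R. if R = RelSym 2 0 then {[a, b, c]} else {})\<rparr>"
  define N :: "'u model" where
    "N = \<lparr>vocab = UNIV, universe = UNIV, interp = (\<lambda>R. {})\<rparr>"
  have "sat M s \<psi> \<longleftrightarrow> sat N s \<psi>" for s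
  proof (rule sat_cong_few_vars[where k = 2 and X = "vars \<psi>"])
    show "card (vars \<psi>) \<le> 2" using \<psi> by (simp add: sentences_def FOC2_def)
    show "as \<in> interp M R \<longleftrightarrow> as \<in> interp N R" if "card (set as) \<le> 2" for R as
      using that abc by (auto simp: M_def N_def)
  qed (simp_all add: M_def N_def finite_vars)
  then have same: "true_in M \<psi> \<longleftrightarrow> true_in N \<psi>"
    by (simp add: true_in_def M_def N_def)
  have models: "is_model M" "is_model N"
    by (auto simp: is_model_def M_def N_def)
  have fv: "fv some_triple = {}" using some_triple_UF1 by (simp add: sentences_def)
  have "true_in M some_triple"
    by (subst true_in_sentence[OF fv, where s = "\<lambda>_. a"]) (auto simp: M_def some_triple_def)
  moreover have "\<not> true_in N some_triple"
    by (subst true_in_sentence[OF fv, where s = "\<lambda>_. a"]) (auto simp: N_def some_triple_def)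
  ultimately show ?thesis
    using models same by (intro not_equivalentI[of M N]) (auto simp: M_def N_def)
qed

lemma some_non_edge_not_GNFO:
  fixes a b :: 'u
  assumes ab: "a \<noteq> b" and \<psi>: "\<psi> \<in> sentences GNFO"
  shows "\<not> equivalent TYPE('u) some_non_edge \<psi>"
proof -
  have fv: "fv some_non_edge = {}" "fv \<psi> = {}"
    using some_non_edge_UF1 \<psi> by (simp_all add: sentences_def)
  have true_iff: "true_in (diagonal A) \<phi> \<longleftrightarrow> sat (diagonal A) (\<lambda>_. a) \<phi>"
    if "fv \<phi> = {}" "a \<in> A" for A \<phi>
    by (rule true_in_sentence) (use that in \<open>auto simp: diagonal_def\<close>)
  have "sat (diagonal {a, b}) (\<lambda>_. a) \<psi> \<longleftrightarrow> sat (diagonal {a}) (\<lambda>_. a) \<psi>"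
    using \<psi> GNFO_diagonal[of \<psi> "\<lambda>_. a" "{a, b}" a "{a}"]
      GNFO_diagonal[of \<psi> "\<lambda>_. a" "{a}" a "{a, b}"]
    by (auto simp: sentences_def)
  then have "true_in (diagonal {a, b}) \<psi> \<longleftrightarrow> true_in (diagonal {a}) \<psi>"
    using true_iff fv by simp
  moreover have "true_in (diagonal {a, b}) some_non_edge"
    using ab by (simp add: true_iff fv) (auto simp: some_non_edge_def diagonal_def)
  moreover have "\<not> true_in (diagonal {a}) some_non_edge"
    by (simp add: true_iff fv) (auto simp: some_non_edge_def diagonal_def)
  ultimately show ?thesis
    by (intro not_equivalentI[of "diagonal {a, b}" "diagonal {a}"])
      (auto simp: is_model_diagonal, auto simp: diagonal_def)
qed

lemma some_proper_edge_not_UF1: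
  fixes a b :: 'u
  assumes ab: "a \<noteq> b" and \<phi>: "\<phi> \<in> sentences UF1"
  shows "\<not> equivalent TYPE('u) some_proper_edge \<phi>"
proof -
  have fv: "fv some_proper_edge = {}"
    using some_proper_edge_GNFO by (simp add: sentences_def)
  have true_iff: "true_in (complete A) some_proper_edge
      \<longleftrightarrow> sat (complete A) (\<lambda>_. a) some_proper_edge" if "a \<in> A" for A
    by (rule true_in_sentence[OF fv]) (use that in \<open>auto simp: complete_def\<close>)
  have "true_in (complete {a, b}) some_proper_edge"
    using ab by (simp add: true_iff) (auto simp: some_proper_edge_def complete_def)
  moreover have "\<not> true_in (complete {a}) some_proper_edge"
    by (simp add: true_iff) (auto simp: some_proper_edge_def complete_def)
  moreover have "true_in (complete {a, b}) \<phi> \<longleftrightarrow> true_in (complete {a}) \<phi>"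
    using \<phi> by (intro true_in_complete_UF1) simp_all
  ultimately show ?thesis
    by (intro not_equivalentI[of "complete {a, b}" "complete {a}"])
      (auto simp: is_model_complete, auto simp: complete_def)
qed

theorem theoremD1:
  assumes "infinite (UNIV :: 'u set)"
  shows "\<forall>L \<in> {FOC2, GNFO}.
    (\<exists>\<phi> \<in> sentences UF1. \<forall>\<psi> \<in> sentences L. \<not> equivalent TYPE('u) \<phi> \<psi>) \<and>
    (\<exists>\<psi> \<in> sentences L. \<forall>\<phi> \<in> sentences UF1. \<not> equivalent TYPE('u) \<psi> \<phi>)"
proof -
  obtain T :: "'u set" where "card T = 2"
    using infinite_arbitrarily_large[OF assms] by blast
  then obtain a b :: 'u where "a \<noteq> b" by (auto simp: card_2_iff)
  show ?thesis
  proof (intro ballI conjI)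
    fix L
    assume L: "L \<in> {FOC2, GNFO}"
    show "\<exists>\<phi> \<in> sentences UF1. \<forall>\<psi> \<in> sentences L. \<not> equivalent TYPE('u) \<phi> \<psi>"
    proof (cases "L = FOC2")
      case True
      then show ?thesis
        using some_triple_not_FOC2[OF assms] some_triple_UF1 by (intro bexI[of _ some_triple] ballI) simp_all
    next
      case False
      then have "L = GNFO" using L by simp
      then show ?thesis
        using some_non_edge_not_GNFO[OF \<open>a \<noteq> b\<close>] some_non_edge_UF1
        by (intro bexI[of _ some_non_edge] ballI) simp_all
    qed
    show "\<exists>\<psi> \<in> sentences L. \<forall>\<phi> \<in> sentences UF1. \<not> equivalent TYPE('u) \<psi> \<phi>"
    proof (intro bexI ballI)
      show "some_proper_edge \<in> sentences L"
        using L some_proper_edge_FOC2 some_proper_edge_GNFO by blast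
    qed (rule some_proper_edge_not_UF1[OF \<open>a \<noteq> b\<close>])
  qed
qed

end
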